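(* Let $R$ be a commutative ring with unity and let $G$ be a subgroup of $\mathrm{Aut}(R)$ whose action on $R$ is locally finite. If $R$ is a Hilbert ring, then the fixed ring $R^G$ is also a Hilbert ring.
   Context: $\mathrm{Aut}(R)$ is the group of ring automorphisms of $R$. For a subgroup $G$ of $\mathrm{Aut}(R)$, the fixed ring is $R^G=\{r\in R : \sigma(r)=r \text{ for all } \sigma\in G\}$. The action of $G$ on $R$ is locally finite if for every $r\in R$ the orbit $\{\sigma(r) : \sigma\in G\}$ is finite ($G$ itself need not be finite). An integral domain $D$ with quotient field $K$ is a G-domain if $K$ is finitely generated as a ring over $D$ (equivalently, $K$ is generated as a ring over $D$ by a single element). A prime ideal $\mathfrak{p}$ of a commutative ring $R$ is a G-ideal if $R/\mathfrak{p}$ is a G-domain. (The "G" in "G-domain" and "G-ideal" is unrelated to the group $G$.) A commutative ring $R$ is a Hilbert ring (or Jacobson ring) if every G-ideal of $R$ is maximal. *)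

theory Defs
  imports "HOL-Algebra.Algebra"
begin

text \<open>Automorphisms are taken extensional on the carrier, as in \<^theory>\<open>HOL-Algebra.Bij\<close>,
  so that equality of automorphisms is equality of HOL functions.\<close>

definition ring_auto :: "('a, 'b) ring_scheme \<Rightarrow> ('a \<Rightarrow> 'a) set" where
  "ring_auto R = ring_iso R R \<inter> Bij (carrier R)"

definition RingAutGroup :: "('a, 'b) ring_scheme \<Rightarrow> ('a \<Rightarrow> 'a) monoid" where
  "RingAutGroup R = BijGroup (carrier R) \<lparr>carrier := ring_auto R\<rparr>"

definition fixed_ring :: "('a, 'b) ring_scheme \<Rightarrow> ('a \<Rightarrow> 'a) set \<Rightarrow> ('a, 'b) ring_scheme" where
  "fixed_ring R G = R \<lparr>carrier := {r \<in> carrier R. \<forall>\<sigma>\<in>G. \<sigma> r = r}\<rparr>"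

definition locally_finite_action :: "('a, 'b) ring_scheme \<Rightarrow> ('a \<Rightarrow> 'a) set \<Rightarrow> bool" where
  "locally_finite_action R G \<longleftrightarrow> (\<forall>r\<in>carrier R. finite {\<sigma> r |\<sigma>. \<sigma> \<in> G})"

text \<open>The quotient field of a domain, as equivalence classes of pairs
  (numerator, nonzero denominator).\<close>

definition frac_pairs :: "('a, 'b) ring_scheme \<Rightarrow> ('a \<times> 'a) set" where
  "frac_pairs D = carrier D \<times> (carrier D - {\<zero>\<^bsub>D\<^esub>})"

definition frac_rel :: "('a, 'b) ring_scheme \<Rightarrow> (('a \<times> 'a) \<times> ('a \<times> 'a)) set" where
  "frac_rel D = {((a, b), (c, d)). (a, b) \<in> frac_pairs D \<and> (c, d) \<in> frac_pairs D \<and>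
     a \<otimes>\<^bsub>D\<^esub> d = c \<otimes>\<^bsub>D\<^esub> b}"

definition fraction :: "('a, 'b) ring_scheme \<Rightarrow> 'a \<Rightarrow> 'a \<Rightarrow> ('a \<times> 'a) set" where
  "fraction D a b = frac_rel D `` {(a, b)}"

text \<open>In the operations below all members of each union coincide, since the operations
  respect the equivalence relation.\<close>

definition quotient_field :: "('a, 'b) ring_scheme \<Rightarrow> ('a \<times> 'a) set ring" where
  "quotient_field D =
    \<lparr>carrier = frac_pairs D // frac_rel D,
     monoid.mult = (\<lambda>U V. \<Union>p\<in>U. \<Union>q\<in>V.
       fraction D (fst p \<otimes>\<^bsub>D\<^esub> fst q) (snd p \<otimes>\<^bsub>D\<^esub> snd q)),
     monoid.one = fraction D \<one>\<^bsub>D\<^esub> \<one>\<^bsub>D\<^esub>,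
     ring.zero = fraction D \<zero>\<^bsub>D\<^esub> \<one>\<^bsub>D\<^esub>,
     ring.add = (\<lambda>U V. \<Union>p\<in>U. \<Union>q\<in>V.
       fraction D (fst p \<otimes>\<^bsub>D\<^esub> snd q \<oplus>\<^bsub>D\<^esub> fst q \<otimes>\<^bsub>D\<^esub> snd p)
         (snd p \<otimes>\<^bsub>D\<^esub> snd q))\<rparr>"

definition frac_embed :: "('a, 'b) ring_scheme \<Rightarrow> 'a \<Rightarrow> ('a \<times> 'a) set" where
  "frac_embed D a = fraction D a \<one>\<^bsub>D\<^esub>"

definition G_domain :: "('a, 'b) ring_scheme \<Rightarrow> bool" where
  "G_domain D \<longleftrightarrow> domain D \<and>
    (\<exists>S. finite S \<and> S \<subseteq> carrier (quotient_field D) \<and>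
      generate_ring (quotient_field D) (frac_embed D ` carrier D \<union> S) =
        carrier (quotient_field D))"

definition G_ideal :: "'a set \<Rightarrow> ('a, 'b) ring_scheme \<Rightarrow> bool" where
  "G_ideal P R \<longleftrightarrow> primeideal P R \<and> G_domain (R Quot P)"

definition Hilbert_ring :: "('a, 'b) ring_scheme \<Rightarrow> bool" where
  "Hilbert_ring R \<longleftrightarrow> cring R \<and> (\<forall>P. G_ideal P R \<longrightarrow> maximalideal P R)"

context domain
begin

lemma equiv_frac_rel: "equiv (frac_pairs R) (frac_rel R)"
proof (rule equivI)
  show "frac_rel R \<subseteq> frac_pairs R \<times> frac_pairs R"
    by (auto simp: frac_rel_def)
  show "refl_on (frac_pairs R) (frac_rel R)"
    by (auto simp: refl_on_def frac_rel_def)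
  show "sym (frac_rel R)"
    by (auto simp: sym_def frac_rel_def)
  show "trans (frac_rel R)"
  proof (rule transI, clarify)
    fix a b c d e f
    assume "((a, b), (c, d)) \<in> frac_rel R" "((c, d), (e, f)) \<in> frac_rel R"
    then have c: "a \<in> carrier R" "b \<in> carrier R" "c \<in> carrier R" "d \<in> carrier R"
        "e \<in> carrier R" "f \<in> carrier R" "b \<noteq> \<zero>" "d \<noteq> \<zero>" "f \<noteq> \<zero>"
      and 1: "a \<otimes> d = c \<otimes> b" and 2: "c \<otimes> f = e \<otimes> d"
      by (auto simp: frac_rel_def frac_pairs_def)
    have "d \<otimes> (a \<otimes> f) = (a \<otimes> d) \<otimes> f" using c by (simp add: m_ac a_ac l_distr r_distr)
    also have "\<dots> = (c \<otimes> f) \<otimes> b" unfolding 1 using c by (simp add: m_ac a_ac l_distr r_distr)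
    also have "\<dots> = d \<otimes> (e \<otimes> b)" unfolding 2 using c by (simp add: m_ac a_ac l_distr r_distr)
    finally have "a \<otimes> f = e \<otimes> b" using c m_lcancel by simp
    then show "((a, b), (e, f)) \<in> frac_rel R"
      using c by (auto simp: frac_rel_def frac_pairs_def)
  qed
qed

lemma frac_eq_iff:
  assumes "a \<in> carrier R" "b \<in> carrier R - {\<zero>}" "c \<in> carrier R" "d \<in> carrier R - {\<zero>}"
  shows "fraction R a b = fraction R c d \<longleftrightarrow> a \<otimes> d = c \<otimes> b"
  using assms eq_equiv_class_iff[OF equiv_frac_rel, of "(a, b)" "(c, d)"]
  by (auto simp: fraction_def frac_rel_def frac_pairs_def)

lemma frac_closed:
  assumes "a \<in> carrier R" "b \<in> carrier R - {\<zero>}"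
  shows "fraction R a b \<in> carrier (quotient_field R)"
  using assms by (auto simp: quotient_field_def fraction_def frac_pairs_def intro: quotientI)

lemma quotient_fieldE:
  assumes "x \<in> carrier (quotient_field R)"
  obtains a b where "a \<in> carrier R" "b \<in> carrier R - {\<zero>}" "x = fraction R a b"
  using assms by (auto simp: quotient_field_def fraction_def frac_pairs_def elim!: quotientE)

lemma frac_mult:
  assumes "a \<in> carrier R" "b \<in> carrier R - {\<zero>}" "c \<in> carrier R" "d \<in> carrier R - {\<zero>}"
  shows "fraction R a b \<otimes>\<^bsub>quotient_field R\<^esub> fraction R c d = fraction R (a \<otimes> c) (b \<otimes> d)"
proof -
  have "(\<lambda>p q. fraction R (fst p \<otimes> fst q) (snd p \<otimes> snd q))
          respects2 frac_rel R"
  proof (rule congruent2I', clarsimp)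
    fix a b a' b' c d c' d'
    assume "((a, b), (a', b')) \<in> frac_rel R" "((c, d), (c', d')) \<in> frac_rel R"
    then have c: "a \<in> carrier R" "b \<in> carrier R" "a' \<in> carrier R" "b' \<in> carrier R"
        "c \<in> carrier R" "d \<in> carrier R" "c' \<in> carrier R" "d' \<in> carrier R"
        "b \<noteq> \<zero>" "d \<noteq> \<zero>" "b' \<noteq> \<zero>" "d' \<noteq> \<zero>"
      and 1: "a \<otimes> b' = a' \<otimes> b" and 2: "c \<otimes> d' = c' \<otimes> d"
      by (auto simp: frac_rel_def frac_pairs_def)
    have "(a \<otimes> c) \<otimes> (b' \<otimes> d') = (a \<otimes> b') \<otimes> (c \<otimes> d')" using c by (simp add: m_ac a_ac l_distr r_distr)
    also have "\<dots> = (a' \<otimes> c') \<otimes> (b \<otimes> d)" unfolding 1 2 using c by (simp add: m_ac a_ac l_distr r_distr)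
    finally show "fraction R (a \<otimes> c) (b \<otimes> d) = fraction R (a' \<otimes> c') (b' \<otimes> d')"
      using c by (subst frac_eq_iff) (auto simp: integral_iff)
  qed
  from UN_equiv_class2[OF equiv_frac_rel equiv_frac_rel this, of "(a, b)" "(c, d)"]
  show ?thesis
    using assms by (simp add: quotient_field_def fraction_def frac_pairs_def)
qed

lemma frac_add:
  assumes "a \<in> carrier R" "b \<in> carrier R - {\<zero>}" "c \<in> carrier R" "d \<in> carrier R - {\<zero>}"
  shows "fraction R a b \<oplus>\<^bsub>quotient_field R\<^esub> fraction R c d = fraction R (a \<otimes> d \<oplus> c \<otimes> b) (b \<otimes> d)"
proof -
  have "(\<lambda>p q. fraction R (fst p \<otimes> snd q \<oplus> fst q \<otimes> snd p) (snd p \<otimes> snd q))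
          respects2 frac_rel R"
  proof (rule congruent2I', clarsimp)
    fix a b a' b' c d c' d'
    assume "((a, b), (a', b')) \<in> frac_rel R" "((c, d), (c', d')) \<in> frac_rel R"
    then have c: "a \<in> carrier R" "b \<in> carrier R" "a' \<in> carrier R" "b' \<in> carrier R"
        "c \<in> carrier R" "d \<in> carrier R" "c' \<in> carrier R" "d' \<in> carrier R"
        "b \<noteq> \<zero>" "d \<noteq> \<zero>" "b' \<noteq> \<zero>" "d' \<noteq> \<zero>"
      and 1: "a \<otimes> b' = a' \<otimes> b" and 2: "c \<otimes> d' = c' \<otimes> d"
      by (auto simp: frac_rel_def frac_pairs_def)
    have "(a \<otimes> d \<oplus> c \<otimes> b) \<otimes> (b' \<otimes> d') =
        (a \<otimes> b') \<otimes> (d \<otimes> d') \<oplus> (c \<otimes> d') \<otimes> (b \<otimes> b')" using c by (simp add: m_ac a_ac l_distr r_distr)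
    also have "\<dots> = (a' \<otimes> d' \<oplus> c' \<otimes> b') \<otimes> (b \<otimes> d)" unfolding 1 2 using c by (simp add: m_ac a_ac l_distr r_distr)
    finally show "fraction R (a \<otimes> d \<oplus> c \<otimes> b) (b \<otimes> d) = fraction R (a' \<otimes> d' \<oplus> c' \<otimes> b') (b' \<otimes> d')"
      using c by (subst frac_eq_iff) (auto simp: integral_iff)
  qed
  from UN_equiv_class2[OF equiv_frac_rel equiv_frac_rel this, of "(a, b)" "(c, d)"]
  show ?thesis
    using assms by (simp add: quotient_field_def fraction_def frac_pairs_def)
qed

lemma quotient_field_zero: "\<zero>\<^bsub>quotient_field R\<^esub> = fraction R \<zero> \<one>"
  and quotient_field_one: "\<one>\<^bsub>quotient_field R\<^esub> = fraction R \<one> \<one>"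
  by (simp_all add: quotient_field_def)

lemma cring_quotient_field: "cring (quotient_field R)"
proof (rule cringI)
  note simps = quotient_field_zero quotient_field_one frac_mult frac_add frac_closed
    frac_eq_iff integral_iff
  show "abelian_group (quotient_field R)"
  proof (rule abelian_groupI)
    fix x assume "x \<in> carrier (quotient_field R)"
    then obtain a b where x: "a \<in> carrier R" "b \<in> carrier R - {\<zero>}" "x = fraction R a b"
      by (rule quotient_fieldE)
    have "fraction R (\<ominus> a) b \<oplus>\<^bsub>quotient_field R\<^esub> x = \<zero>\<^bsub>quotient_field R\<^esub>"
      using x by (simp add: simps m_ac a_ac l_minus r_minus r_neg l_neg)
    then show "\<exists>y\<in>carrier (quotient_field R). y \<oplus>\<^bsub>quotient_field R\<^esub> x = \<zero>\<^bsub>quotient_field R\<^esub>"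
      using x by (intro bexI[of _ "fraction R (\<ominus> a) b"]) (simp_all add: frac_closed)
  next
    fix x y z assume "x \<in> carrier (quotient_field R)" "y \<in> carrier (quotient_field R)"
      "z \<in> carrier (quotient_field R)"
    then show "x \<oplus>\<^bsub>quotient_field R\<^esub> y \<oplus>\<^bsub>quotient_field R\<^esub> z =
        x \<oplus>\<^bsub>quotient_field R\<^esub> (y \<oplus>\<^bsub>quotient_field R\<^esub> z)"
      by (elim quotient_fieldE) (simp add: simps m_ac a_ac l_distr r_distr)
  next
    fix x y assume "x \<in> carrier (quotient_field R)" "y \<in> carrier (quotient_field R)"
    then show "x \<oplus>\<^bsub>quotient_field R\<^esub> y = y \<oplus>\<^bsub>quotient_field R\<^esub> x"
      by (elim quotient_fieldE) (simp add: simps m_ac a_ac l_distr r_distr)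
  qed (((elim quotient_fieldE)?; simp add: simps)+)
  show "comm_monoid (quotient_field R)"
  proof (rule comm_monoidI)
    fix x y z assume "x \<in> carrier (quotient_field R)" "y \<in> carrier (quotient_field R)"
      "z \<in> carrier (quotient_field R)"
    then show "x \<otimes>\<^bsub>quotient_field R\<^esub> y \<otimes>\<^bsub>quotient_field R\<^esub> z =
        x \<otimes>\<^bsub>quotient_field R\<^esub> (y \<otimes>\<^bsub>quotient_field R\<^esub> z)"
      by (elim quotient_fieldE) (simp add: simps m_ac a_ac l_distr r_distr)
  next
    fix x y assume "x \<in> carrier (quotient_field R)" "y \<in> carrier (quotient_field R)"
    then show "x \<otimes>\<^bsub>quotient_field R\<^esub> y = y \<otimes>\<^bsub>quotient_field R\<^esub> x"
      by (elim quotient_fieldE) (simp add: simps m_ac a_ac l_distr r_distr)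
  qed (((elim quotient_fieldE)?; simp add: simps)+)
  fix x y z assume "x \<in> carrier (quotient_field R)" "y \<in> carrier (quotient_field R)"
    "z \<in> carrier (quotient_field R)"
  then show "(x \<oplus>\<^bsub>quotient_field R\<^esub> y) \<otimes>\<^bsub>quotient_field R\<^esub> z =
      x \<otimes>\<^bsub>quotient_field R\<^esub> z \<oplus>\<^bsub>quotient_field R\<^esub> y \<otimes>\<^bsub>quotient_field R\<^esub> z"
    by (elim quotient_fieldE) (simp add: simps m_ac a_ac l_distr r_distr)
qed

theorem field_quotient_field: "field (quotient_field R)"
proof (rule cring.cring_fieldI2[OF cring_quotient_field])
  show "\<zero>\<^bsub>quotient_field R\<^esub> \<noteq> \<one>\<^bsub>quotient_field R\<^esub>"
    by (simp add: quotient_field_zero quotient_field_one frac_eq_iff)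
next
  fix x assume x0: "x \<in> carrier (quotient_field R)" "x \<noteq> \<zero>\<^bsub>quotient_field R\<^esub>"
  then obtain a b where x: "a \<in> carrier R" "b \<in> carrier R - {\<zero>}" "x = fraction R a b"
    by (elim quotient_fieldE)
  with x0 have "a \<noteq> \<zero>" by (auto simp: quotient_field_zero frac_eq_iff)
  then show "\<exists>y\<in>carrier (quotient_field R). x \<otimes>\<^bsub>quotient_field R\<^esub> y = \<one>\<^bsub>quotient_field R\<^esub>"
    using x by (intro bexI[of _ "fraction R b a"])
      (auto simp: quotient_field_one frac_mult frac_eq_iff frac_closed integral_iff m_comm)
qed

theorem frac_embed_hom: "frac_embed R \<in> ring_hom R (quotient_field R)"
  by (rule ring_hom_memI)
    (simp_all add: frac_embed_def frac_closed frac_mult frac_add quotient_field_one)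

theorem inj_frac_embed: "inj_on (frac_embed R) (carrier R)"
  by (rule inj_onI) (simp add: frac_embed_def frac_eq_iff)

theorem frac_embed_quotient:
  assumes "a \<in> carrier R" "b \<in> carrier R - {\<zero>}"
  shows "fraction R a b \<otimes>\<^bsub>quotient_field R\<^esub> frac_embed R b = frac_embed R a"
  using assms by (simp add: frac_embed_def frac_mult frac_eq_iff integral_iff m_assoc)

end

lemma (in ring) ring_auto_alt:
  "ring_auto R = {f \<in> Bij (carrier R). f \<in> ring_hom R R}"
  by (auto simp: ring_auto_def ring_iso_def Bij_def)

lemma (in ring) subgroup_ring_auto: "subgroup (ring_auto R) (BijGroup (carrier R))"
proof (rule group.subgroupI[OF group_BijGroup])
  show "ring_auto R \<subseteq> carrier (BijGroup (carrier R))"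
    by (auto simp: ring_auto_def BijGroup_def)
  have "(\<lambda>x\<in>carrier R. x) \<in> ring_auto R"
    unfolding ring_auto_alt using id_Bij by (auto intro!: ring_hom_memI)
  then show "ring_auto R \<noteq> {}" by blast
next
  fix f assume f: "f \<in> ring_auto R"
  then have hom: "f \<in> ring_hom R R" and B: "f \<in> Bij (carrier R)"
    by (auto simp: ring_auto_alt)
  then have bij: "bij_betw f (carrier R) (carrier R)" by (simp add: Bij_def)
  let ?g = "\<lambda>x\<in>carrier R. inv_into (carrier R) f x"
  have gc: "?g x \<in> carrier R" and fg: "f (?g x) = x" if "x \<in> carrier R" for x
    using that Bij_inv_into_mem[OF B that] bij_betw_inv_into_right[OF bij that] by simp_all
  have inj: "x = y" if "f x = f y" "x \<in> carrier R" "y \<in> carrier R" for x y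
    using that bij by (auto simp: bij_betw_def dest: inj_onD)
  have "?g \<in> ring_hom R R"
  proof (rule ring_hom_memI)
    fix x y assume xy: "x \<in> carrier R" "y \<in> carrier R"
    show "?g (x \<otimes> y) = ?g x \<otimes> ?g y"
      by (rule inj) (use xy gc fg ring_hom_mult[OF hom] in \<open>simp_all del: restrict_apply\<close>)
    show "?g (x \<oplus> y) = ?g x \<oplus> ?g y"
      by (rule inj) (use xy gc fg ring_hom_add[OF hom] in \<open>simp_all del: restrict_apply\<close>)
  next
    show "?g \<one> = \<one>"
      by (rule inj) (use gc fg ring_hom_one[OF hom] in \<open>simp_all del: restrict_apply\<close>)
  qed (use gc in blast)
  then show "inv\<^bsub>BijGroup (carrier R)\<^esub> f \<in> ring_auto R"
    using B by (simp add: inv_BijGroup ring_auto_alt restrict_inv_into_Bij)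
next
  fix f g assume "f \<in> ring_auto R" "g \<in> ring_auto R"
  then show "f \<otimes>\<^bsub>BijGroup (carrier R)\<^esub> g \<in> ring_auto R"
    by (auto simp: ring_auto_alt BijGroup_def compose_Bij[unfolded compose_def] compose_def
        ring_hom_closed ring_hom_mult ring_hom_add ring_hom_one intro!: ring_hom_memI)
qed

theorem (in ring) group_RingAutGroup: "group (RingAutGroup R)"
  unfolding RingAutGroup_def
  by (rule subgroup.subgroup_is_group[OF subgroup_ring_auto group_BijGroup])

end

theory Submission
  imports Defs
begin

text \<open>Write \<open>A\<close> for the fixed ring and let \<open>P\<close> be a G-ideal of \<open>A\<close>. The plan is to find a G-ideal
  \<open>Q\<close> of \<open>R\<close> lying over \<open>P\<close>; it is maximal because \<open>R\<close> is a Hilbert ring, and maximality then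
  descends to \<open>P\<close>.

  Two tools make this elementary. The first (\<open>G_ideal_iff_divides_power\<close>) removes quotient fields:
  a prime \<open>P\<close> is a G-ideal exactly when there is \<open>u\<close> outside \<open>P\<close> such that every element outside \<open>P\<close>
  divides, modulo \<open>P\<close>, some power of \<open>u\<close>. The second (\<open>fixed_ring_norm\<close>) replaces integrality of \<open>R\<close> over
  \<open>A\<close>: for \<open>a\<close>, \<open>t\<close> in \<open>A\<close> and \<open>r\<close> in \<open>R\<close>, the product of \<open>t + a r'\<close> over the finite orbit of \<open>r\<close>
  is a multiple of \<open>t + a r\<close>, and it has the form \<open>t\<^sup>n + a s\<close> with \<open>s\<close> in \<open>A\<close>. Consequently, if an
  ideal \<open>Q\<close> of \<open>R\<close> satisfies \<open>Q \<inter> A \<subseteq> P\<close>, then a relation \<open>t - a r \<in> Q\<close> with coefficients \<open>a\<close>, \<open>t\<close>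
  in \<open>A\<close> but \<open>r\<close> merely in \<open>R\<close> yields a relation \<open>t\<^sup>n + a s \<in> P\<close> entirely inside \<open>A\<close>.

  Choose \<open>Q\<close> maximal among the ideals of \<open>R\<close> disjoint from \<open>A - P\<close>; it is prime, and every \<open>b\<close>
  outside \<open>Q\<close> satisfies \<open>t \<in> b R + Q\<close> for some \<open>t\<close> in \<open>A - P\<close>. If some \<open>a\<close> in \<open>P\<close> were outside
  \<open>Q\<close>, then \<open>t - a r \<in> Q\<close> with \<open>t\<close> in \<open>A - P\<close>, so \<open>t\<^sup>n + a s \<in> P\<close> and \<open>t \<in> P\<close>, which is absurd;
  hence \<open>P \<subseteq> Q\<close>. Since a power of \<open>u\<close> lies in \<open>t A + P\<close>, it also lies in \<open>b R + Q\<close>, so \<open>u\<close> witnesses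
  that \<open>Q\<close> is a G-ideal. Finally, for \<open>b\<close> in \<open>A - P\<close> maximality of \<open>Q\<close> gives \<open>1 - b c \<in> Q\<close>, and the
  norm with \<open>t = 1\<close> gives \<open>1 + b s \<in> P\<close> with \<open>s\<close> in \<open>A\<close>: so \<open>b\<close> is a unit modulo \<open>P\<close>.\<close>

section \<open>Fractions with bounded denominators\<close>

context domain
begin

text \<open>The localization of the domain at the powers of \<open>u\<close>, as a subset of its quotient field.\<close>

definition power_denominators :: "'a \<Rightarrow> ('a \<times> 'a) set set" where
  "power_denominators u = {fraction R a (u [^] (n::nat)) |a n. a \<in> carrier R}"

lemma nonzero_pow:
  assumes "u \<in> carrier R - {\<zero>}"
  shows "u [^] (n::nat) \<in> carrier R - {\<zero>}"
proof (induction n)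
  case (Suc n)
  then show ?case using assms by (auto simp: integral_iff)
qed simp

lemma fraction_expand:
  assumes "a \<in> carrier R" "b \<in> carrier R - {\<zero>}" "c \<in> carrier R - {\<zero>}"
  shows "fraction R (a \<otimes> c) (b \<otimes> c) = fraction R a b"
  using assms by (subst frac_eq_iff) (auto simp: integral_iff m_ac)

text \<open>Fractions whose denominator is a power of \<open>u\<close> already form a ring, so adjoining such fractions
  never produces other denominators.\<close>

lemma generate_ring_power_denominators:
  assumes u: "u \<in> carrier R - {\<zero>}" and S: "S \<subseteq> power_denominators u"
    and x: "x \<in> generate_ring (quotient_field R) (frac_embed R ` carrier R \<union> S)"
  shows "x \<in> power_denominators u"
  using x
proof (induction rule: generate_ring.induct)
  case one
  have "\<one>\<^bsub>quotient_field R\<^esub> = fraction R \<one> (u [^] (0::nat))"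
    by (simp add: quotient_field_one)
  then show ?case unfolding power_denominators_def by blast
next
  case (incl h)
  have "frac_embed R a = fraction R a (u [^] (0::nat))" for a
    by (simp add: frac_embed_def)
  then show ?case using incl S unfolding power_denominators_def by blast
next
  case (a_inv h)
  then obtain a n where a: "a \<in> carrier R" "h = fraction R a (u [^] (n::nat))"
    by (auto simp: power_denominators_def)
  interpret K: cring "quotient_field R" by (rule cring_quotient_field)
  have "h \<oplus>\<^bsub>quotient_field R\<^esub> fraction R (\<ominus> a) (u [^] n) = \<zero>\<^bsub>quotient_field R\<^esub>"
    using a nonzero_pow[OF u, of n]
    by (simp add: frac_add quotient_field_zero frac_eq_iff integral_iff l_minus r_neg)
  then have "\<ominus>\<^bsub>quotient_field R\<^esub> h = fraction R (\<ominus> a) (u [^] n)"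
    using a nonzero_pow[OF u, of n] by (metis K.minus_equality K.a_comm frac_closed a_inv_closed)
  then show ?case using a unfolding power_denominators_def by blast
next
  case (eng_add h1 h2)
  then obtain a n b m where a: "a \<in> carrier R" "h1 = fraction R a (u [^] (n::nat))"
    and b: "b \<in> carrier R" "h2 = fraction R b (u [^] (m::nat))"
    by (auto simp: power_denominators_def)
  have "h1 \<oplus>\<^bsub>quotient_field R\<^esub> h2 =
      fraction R (a \<otimes> u [^] m \<oplus> b \<otimes> u [^] n) (u [^] (n + m))"
    using a b u nonzero_pow[OF u] by (simp add: frac_add nat_pow_mult)
  then show ?case using a b u unfolding power_denominators_def by blast
next
  case (eng_mult h1 h2)
  then obtain a n b m where a: "a \<in> carrier R" "h1 = fraction R a (u [^] (n::nat))"
    and b: "b \<in> carrier R" "h2 = fraction R b (u [^] (m::nat))"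
    by (auto simp: power_denominators_def)
  have "h1 \<otimes>\<^bsub>quotient_field R\<^esub> h2 = fraction R (a \<otimes> b) (u [^] (n + m))"
    using a b u nonzero_pow[OF u] by (simp add: frac_mult nat_pow_mult)
  then show ?case using a b u unfolding power_denominators_def by blast
qed

lemma common_denominator:
  assumes "finite S" "S \<subseteq> carrier (quotient_field R)"
  shows "\<exists>u \<in> carrier R - {\<zero>}. \<forall>s\<in>S. \<exists>a\<in>carrier R. s = fraction R a u"
  using assms
proof (induction S)
  case empty
  show ?case by (intro bexI[of _ \<one>]) auto
next
  case (insert s S)
  then obtain u where u: "u \<in> carrier R - {\<zero>}" "\<forall>s\<in>S. \<exists>a\<in>carrier R. s = fraction R a u"
    by auto
  obtain a b where s: "a \<in> carrier R" "b \<in> carrier R - {\<zero>}" "s = fraction R a b"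
    using insert.prems quotient_fieldE[of s] by auto
  have "\<exists>d\<in>carrier R. s' = fraction R d (b \<otimes> u)" if "s' \<in> insert s S" for s'
  proof (cases "s' = s")
    case True
    then have "s' = fraction R (a \<otimes> u) (b \<otimes> u)"
      using s u by (simp add: fraction_expand)
    then show ?thesis using s u by blast
  next
    case False
    then have "s' \<in> S" using that by blast
    then obtain d where d: "d \<in> carrier R" "s' = fraction R d u" using u(2) by blast
    then have "s' = fraction R (d \<otimes> b) (u \<otimes> b)"
      using s u by (simp add: fraction_expand)
    then have "s' = fraction R (d \<otimes> b) (b \<otimes> u)" using s u by (simp add: m_comm)
    then show ?thesis using s d by blast
  qed
  then show ?case using s u by (intro bexI[of _ "b \<otimes> u"]) (auto simp: integral_iff)
qed

text \<open>A finite set of generators of the quotient field has a common denominator \<open>u\<close>, and then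
  \<open>1/b = a/u\<^sup>n\<close> says that \<open>b\<close> divides \<open>u\<^sup>n\<close>. Conversely such a divisibility \<open>u\<^sup>n = b c\<close> gives
  \<open>a/b = a c (1/u)\<^sup>n\<close>, so the single element \<open>1/u\<close> generates.\<close>

lemma G_domain_iff_divides_power:
  "G_domain R \<longleftrightarrow>
    (\<exists>u \<in> carrier R - {\<zero>}. \<forall>b \<in> carrier R - {\<zero>}. \<exists>n::nat. \<exists>c\<in>carrier R. u [^] n = b \<otimes> c)"
proof
  assume "G_domain R"
  then obtain S where S: "finite S" "S \<subseteq> carrier (quotient_field R)"
    and gen: "generate_ring (quotient_field R) (frac_embed R ` carrier R \<union> S) =
        carrier (quotient_field R)"
    by (auto simp: G_domain_def)
  from common_denominator[OF S] obtain u where u: "u \<in> carrier R - {\<zero>}"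
    and Su: "\<forall>s\<in>S. \<exists>a\<in>carrier R. s = fraction R a u" by blast
  have "S \<subseteq> power_denominators u"
  proof
    fix s assume "s \<in> S"
    then obtain a where "a \<in> carrier R" "s = fraction R a (u [^] (1::nat))" using Su u by auto
    then show "s \<in> power_denominators u" unfolding power_denominators_def by blast
  qed
  note K = generate_ring_power_denominators[OF u this, unfolded gen]
  have "\<exists>n::nat. \<exists>c\<in>carrier R. u [^] n = b \<otimes> c" if b: "b \<in> carrier R - {\<zero>}" for b
  proof -
    have "fraction R \<one> b \<in> power_denominators u" using b by (intro K frac_closed) auto
    then obtain a n where a: "a \<in> carrier R" "fraction R \<one> b = fraction R a (u [^] (n::nat))"
      by (auto simp: power_denominators_def)
    then have "u [^] n = b \<otimes> a" using b u nonzero_pow[OF u, of n] by (simp add: frac_eq_iff m_comm)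
    then show ?thesis using a by blast
  qed
  then show "\<exists>u \<in> carrier R - {\<zero>}. \<forall>b \<in> carrier R - {\<zero>}. \<exists>n::nat. \<exists>c\<in>carrier R. u [^] n = b \<otimes> c"
    using u by blast
next
  assume "\<exists>u \<in> carrier R - {\<zero>}. \<forall>b \<in> carrier R - {\<zero>}. \<exists>n::nat. \<exists>c\<in>carrier R. u [^] n = b \<otimes> c"
  then obtain u where u: "u \<in> carrier R - {\<zero>}"
    and div: "\<And>b. b \<in> carrier R - {\<zero>} \<Longrightarrow> \<exists>n::nat. \<exists>c\<in>carrier R. u [^] n = b \<otimes> c" by blast
  interpret K: cring "quotient_field R" by (rule cring_quotient_field)
  let ?v = "fraction R \<one> u"
  let ?H = "frac_embed R ` carrier R \<union> {?v}"
  have H: "?H \<subseteq> carrier (quotient_field R)"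
    using u by (auto simp: frac_embed_def frac_closed)
  have v_pow: "fraction R \<one> (u [^] n) \<in> generate_ring (quotient_field R) ?H" for n :: nat
  proof (induction n)
    case 0
    show ?case using generate_ring.one[of "quotient_field R" ?H]
      by (simp add: quotient_field_one)
  next
    case (Suc n)
    have "fraction R \<one> (u [^] n) \<otimes>\<^bsub>quotient_field R\<^esub> ?v = fraction R \<one> (u [^] Suc n)"
      using u nonzero_pow[OF u, of n] by (simp add: frac_mult)
    then show ?case
      using generate_ring.eng_mult[OF Suc generate_ring.incl[of ?v]] by simp
  qed
  have "x \<in> generate_ring (quotient_field R) ?H" if "x \<in> carrier (quotient_field R)" for x
  proof -
    from that obtain a b where x: "a \<in> carrier R" "b \<in> carrier R - {\<zero>}" "x = fraction R a b"
      by (rule quotient_fieldE)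
    then obtain n c where c: "c \<in> carrier R" "u [^] (n::nat) = b \<otimes> c" using div by blast
    then have c0: "c \<in> carrier R - {\<zero>}" using nonzero_pow[OF u, of n] x by auto
    have "x = fraction R (a \<otimes> c) (u [^] n)"
      using x c c0 by (simp add: fraction_expand)
    also have "\<dots> = frac_embed R (a \<otimes> c) \<otimes>\<^bsub>quotient_field R\<^esub> fraction R \<one> (u [^] n)"
      using x c nonzero_pow[OF u, of n] by (simp add: frac_embed_def frac_mult)
    finally have eq: "x = frac_embed R (a \<otimes> c) \<otimes>\<^bsub>quotient_field R\<^esub> fraction R \<one> (u [^] n)" .
    have "frac_embed R (a \<otimes> c) \<in> ?H" using x c by blast
    then show ?thesis unfolding eq by (intro generate_ring.eng_mult generate_ring.incl v_pow)
  qed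
  then have "generate_ring (quotient_field R) ?H = carrier (quotient_field R)"
    using K.generate_ring_incl[OF H] by blast
  then show "G_domain R"
    unfolding G_domain_def using domain_axioms H by (intro conjI exI[of _ "{?v}"]) auto
qed

end

section \<open>Prime, maximal and G-ideals\<close>

lemma (in ideal) mem_of_add_mem:
  assumes "x \<in> carrier R" "q \<in> I" "x \<oplus> q \<in> I"
  shows "x \<in> I"
proof -
  have "(x \<oplus> q) \<oplus> \<ominus> q \<in> I" using assms by simp
  also have "(x \<oplus> q) \<oplus> \<ominus> q = x" using assms by (simp add: a_assoc r_neg)
  finally show ?thesis .
qed

lemma (in ideal) coset_eq_iff_add:
  assumes "x \<in> carrier R" "y \<in> carrier R"
  shows "I +> x = I +> y \<longleftrightarrow> (\<exists>q\<in>I. x = y \<oplus> q)"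
proof
  assume "I +> x = I +> y"
  then have "x \<in> I +> y" using a_rcos_self[OF assms(1)] by simp
  then show "\<exists>q\<in>I. x = y \<oplus> q"
    using assms(2) by (auto simp: a_r_coset_def' a_comm)
next
  assume "\<exists>q\<in>I. x = y \<oplus> q"
  then obtain q where "q \<in> I" "x = y \<oplus> q" by blast
  then have "x \<in> I +> y" using assms(2) by (auto simp: a_r_coset_def' a_comm)
  then show "I +> x = I +> y" using a_repr_independence[OF _ assms(2) a_subgroup] by simp
qed

text \<open>The divisibility criterion for G-domains, lifted from the residue ring to representatives so
  that ideals of different rings can be compared without passing to quotients.\<close>

lemma G_ideal_iff_divides_power:
  fixes R (structure)
  shows "G_ideal P R \<longleftrightarrow> primeideal P R \<and>
    (\<exists>u \<in> carrier R - P. \<forall>b \<in> carrier R - P.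
      \<exists>n::nat. \<exists>c\<in>carrier R. \<exists>q\<in>P. u [^] n = b \<otimes> c \<oplus> q)"
proof (cases "primeideal P R")
  case True
  interpret primeideal P R by fact
  have carr: "carrier (R Quot P) = (+>) P ` carrier R"
    unfolding FactRing_def A_RCOSETS_def' by (simp add: UNION_singleton_eq_range)
  have zero: "P +> b = \<zero>\<^bsub>R Quot P\<^esub> \<longleftrightarrow> b \<in> P" if "b \<in> carrier R" for b
  proof -
    have "\<zero>\<^bsub>R Quot P\<^esub> = P" unfolding FactRing_def by (rule ring.simps)
    then show ?thesis using rcos_const_imp_mem[OF that] a_rcos_zero[OF is_ideal] by auto
  qed
  have nonzero: "carrier (R Quot P) - {\<zero>\<^bsub>R Quot P\<^esub>} = (+>) P ` (carrier R - P)"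
    unfolding carr using zero by blast
  interpret \<pi>: ring_hom_cring R "R Quot P" "(+>) P" by (rule rcos_ring_hom_cring)
  have eq: "(P +> u) [^]\<^bsub>R Quot P\<^esub> n = (P +> b) \<otimes>\<^bsub>R Quot P\<^esub> (P +> c) \<longleftrightarrow>
      (\<exists>q\<in>P. u [^] n = b \<otimes> c \<oplus> q)"
    if "u \<in> carrier R" "b \<in> carrier R" "c \<in> carrier R" for u b c and n :: nat
  proof -
    have "(P +> u) [^]\<^bsub>R Quot P\<^esub> n = P +> (u [^] n)"
      using that(1) by (induction n) simp_all
    moreover have "(P +> b) \<otimes>\<^bsub>R Quot P\<^esub> (P +> c) = P +> (b \<otimes> c)" using that by simp
    ultimately show ?thesis using that by (simp only: coset_eq_iff_add nat_pow_closed m_closed)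
  qed
  show ?thesis
    unfolding G_ideal_def domain.G_domain_iff_divides_power[OF quotient_is_domain] nonzero
    unfolding carr using True by (simp add: eq)
next
  case False
  then show ?thesis by (simp add: G_ideal_def)
qed

context cring
begin

text \<open>The witness is \<open>J = I + b R\<close>; only the form of its elements matters later.\<close>

lemma ideal_adjoin:
  assumes "ideal I R" "b \<in> carrier R"
  obtains J where "ideal J R" "I \<subseteq> J" "b \<in> J"
    "\<forall>x\<in>J. \<exists>c\<in>carrier R. \<exists>q\<in>I. x = b \<otimes> c \<oplus> q"
proof -
  interpret ideal I R by fact
  define J where "J = I <+>\<^bsub>R\<^esub> PIdl b"
  have J: "x \<in> J \<longleftrightarrow> (\<exists>q\<in>I. \<exists>c\<in>carrier R. x = q \<oplus> c \<otimes> b)" for x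
    by (auto simp: J_def set_add_def' cgenideal_def)
  have "ideal J R"
    unfolding J_def using assms by (intro add_ideals cgenideal_ideal)
  moreover have "I \<subseteq> J"
  proof
    fix q assume "q \<in> I"
    then show "q \<in> J" unfolding J using assms(2) by (intro bexI[of _ q] bexI[of _ \<zero>]) auto
  qed
  moreover have "b \<in> J"
    unfolding J using assms(2) by (intro bexI[of _ \<zero>] bexI[of _ \<one>]) auto
  moreover have "\<exists>c\<in>carrier R. \<exists>q\<in>I. x = b \<otimes> c \<oplus> q" if "x \<in> J" for x
  proof -
    from that obtain q c where x: "q \<in> I" "c \<in> carrier R" "x = q \<oplus> c \<otimes> b"
      unfolding J by blast
    then have "x = b \<otimes> c \<oplus> q" using assms(2) Icarr[of q] by (simp add: a_comm m_comm)
    then show ?thesis using x by blast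
  qed
  ultimately show ?thesis by (intro that) auto
qed

lemma maximalideal_iff_unit_mod:
  assumes "ideal I R"
  shows "maximalideal I R \<longleftrightarrow> \<one> \<notin> I \<and>
    (\<forall>b \<in> carrier R - I. \<exists>c\<in>carrier R. \<exists>q\<in>I. \<one> = b \<otimes> c \<oplus> q)"
proof -
  interpret ideal I R by fact
  show ?thesis
  proof (intro iffI conjI ballI)
    assume "maximalideal I R"
    then interpret maximalideal I R .
    show "\<one> \<notin> I" using one_imp_carrier I_notcarr by auto
    fix b assume b: "b \<in> carrier R - I"
    then have "b \<in> carrier R" by simp
    then obtain J where J: "ideal J R" "I \<subseteq> J" "b \<in> J"
      "\<forall>x\<in>J. \<exists>c\<in>carrier R. \<exists>q\<in>I. x = b \<otimes> c \<oplus> q"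
      by (rule ideal_adjoin[OF is_ideal])
    have "J \<subseteq> carrier R" using ideal.Icarr[OF J(1)] by blast
    then have "J = carrier R" using I_maximal[OF J(1,2)] J(3) b by blast
    then show "\<exists>c\<in>carrier R. \<exists>q\<in>I. \<one> = b \<otimes> c \<oplus> q" using J(4) by blast
  next
    assume *: "\<one> \<notin> I \<and> (\<forall>b \<in> carrier R - I. \<exists>c\<in>carrier R. \<exists>q\<in>I. \<one> = b \<otimes> c \<oplus> q)"
    show "maximalideal I R"
    proof (rule maximalidealI[OF is_ideal])
      show "carrier R \<noteq> I" using * by auto
      fix J assume J: "ideal J R" "I \<subseteq> J" "J \<subseteq> carrier R"
      interpret J: ideal J R by fact
      show "J = I \<or> J = carrier R"
      proof (rule disjCI)
        assume "J \<noteq> carrier R"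
        then have "\<one> \<notin> J" using J.one_imp_carrier by blast
        have "b \<in> I" if "b \<in> J" for b
        proof (rule ccontr)
          assume "b \<notin> I"
          then obtain c q where "c \<in> carrier R" "q \<in> I" "\<one> = b \<otimes> c \<oplus> q"
            using * J \<open>b \<in> J\<close> by blast
          then have "\<one> \<in> J" using \<open>b \<in> J\<close> J by (auto intro: J.I_r_closed)
          with \<open>\<one> \<notin> J\<close> show False ..
        qed
        then show "J = I" using J by blast
      qed
    qed
  qed
qed

text \<open>Zorn's lemma gives an ideal \<open>Q\<close> maximal among those disjoint from \<open>S\<close>. Enlarging \<open>Q\<close> by any
  further element \<open>b\<close> must meet \<open>S\<close>, which is the last property, and primality follows from it: if
  \<open>Q + x R\<close> and \<open>Q + y R\<close> both meet \<open>S\<close>, so does \<open>Q + x y R\<close>. The property is kept in the conclusion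
  since it says more than primality.\<close>

lemma prime_ideal_avoiding_submonoid:
  assumes S: "S \<subseteq> carrier R" "\<one> \<in> S" "\<And>s t. s \<in> S \<Longrightarrow> t \<in> S \<Longrightarrow> s \<otimes> t \<in> S" "\<zero> \<notin> S"
  obtains Q where "primeideal Q R" "Q \<inter> S = {}"
    "\<forall>b \<in> carrier R - Q. \<exists>s\<in>S. \<exists>c\<in>carrier R. \<exists>q\<in>Q. s = b \<otimes> c \<oplus> q"
proof -
  let ?F = "{J. ideal J R \<and> J \<inter> S = {}}"
  have "\<exists>Q\<in>?F. \<forall>J\<in>?F. Q \<subseteq> J \<longrightarrow> J = Q"
  proof (rule subset_Zorn_nonempty)
    show "?F \<noteq> {}" using zeroideal S by blast
    fix C assume C: "C \<noteq> {}" "subset.chain ?F C"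
    then have "subset.chain {J. ideal J R} C" by (auto simp: subset_chain_def)
    from chain_Union_is_ideal[OF this] C show "\<Union>C \<in> ?F" by (auto simp: subset_chain_def)
  qed
  then obtain Q where Q_F: "Q \<in> ?F" and max: "\<forall>J\<in>?F. Q \<subseteq> J \<longrightarrow> J = Q" ..
  from Q_F have Q: "ideal Q R" "Q \<inter> S = {}" by auto
  interpret ideal Q R by fact
  have meets: "\<exists>s\<in>S. \<exists>c\<in>carrier R. \<exists>q\<in>Q. s = b \<otimes> c \<oplus> q" if b: "b \<in> carrier R - Q" for b
  proof -
    have bR: "b \<in> carrier R" using b by simp
    obtain J where J: "ideal J R" "Q \<subseteq> J" "b \<in> J"
      "\<forall>x\<in>J. \<exists>c\<in>carrier R. \<exists>q\<in>Q. x = b \<otimes> c \<oplus> q"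
      by (rule ideal_adjoin[OF is_ideal bR])
    have "J \<noteq> Q" using J(3) b by auto
    then have "J \<notin> ?F" using max J(2) by blast
    then obtain s where s: "s \<in> S" "s \<in> J" using J(1) by auto
    from bspec[OF J(4) s(2)] s(1) show ?thesis by (rule bexI)
  qed
  have "primeideal Q R"
  proof (rule primeidealI[OF is_ideal is_cring])
    show "carrier R \<noteq> Q" using Q S by auto
    fix x y assume xy: "x \<in> carrier R" "y \<in> carrier R" "x \<otimes> y \<in> Q"
    show "x \<in> Q \<or> y \<in> Q"
    proof (rule ccontr)
      assume "\<not> (x \<in> Q \<or> y \<in> Q)"
      then have "x \<in> carrier R - Q" "y \<in> carrier R - Q" using xy by auto
      from this[THEN meets] obtain s t c d q q'
        where s: "s \<in> S" "c \<in> carrier R" "q \<in> Q" "s = x \<otimes> c \<oplus> q"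
          and t: "t \<in> S" "d \<in> carrier R" "q' \<in> Q" "t = y \<otimes> d \<oplus> q'"
        by (elim bexE)
      have carr: "q \<in> carrier R" "q' \<in> carrier R" using s t by auto
      have "s \<otimes> t = (x \<otimes> y) \<otimes> (c \<otimes> d) \<oplus> (q \<otimes> (y \<otimes> d) \<oplus> q' \<otimes> s)"
        unfolding s(4) t(4) using s(2) t(2) xy(1,2) carr by (simp add: l_distr r_distr m_ac a_ac)
      moreover have "s \<in> carrier R" using s S by blast
      ultimately have "s \<otimes> t \<in> Q" using s t xy by (simp add: I_r_closed)
      then show False using S(3)[OF s(1) t(1)] Q(2) by blast
    qed
  qed
  then show ?thesis using Q(2) meets by (intro that) auto
qed

section \<open>Norms over finite sets\<close>

text \<open>A pair \<open>(c, s)\<close> stands for the expression \<open>c + a s\<close>, and the multiplication is the expansion of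
  \<open>(c + a s) (d + a t)\<close> into the same form. Pairs are needed because \<open>c + a s\<close> determines neither \<open>c\<close>
  nor \<open>s\<close> (the element \<open>a\<close> may be a zero divisor), whereas the second component of a product of pairs
  inherits the symmetry of the factors.\<close>

definition norm_monoid :: "'a \<Rightarrow> ('a \<times> 'a) monoid" where
  "norm_monoid a = \<lparr>carrier = carrier R \<times> carrier R,
     monoid.mult = (\<lambda>(c, s) (d, t). (c \<otimes> d, c \<otimes> t \<oplus> d \<otimes> s \<oplus> a \<otimes> (s \<otimes> t))),
     monoid.one = (\<one>, \<zero>)\<rparr>"

lemma comm_monoid_norm_monoid:
  assumes "a \<in> carrier R"
  shows "comm_monoid (norm_monoid a)"
  by (rule comm_monoidI) (use assms in \<open>auto simp: norm_monoid_def l_distr r_distr m_ac a_ac\<close>)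

text \<open>The element \<open>s\<close> comes from expanding the product of \<open>t + a z\<close> over \<open>z\<close> in \<open>Z\<close>: it is a
  combination of the elementary symmetric functions of \<open>Z\<close>, with coefficients monomials in \<open>t\<close> and
  \<open>a\<close>. Computing the product
  in the commutative monoid of pairs avoids these functions: an endomorphism that fixes \<open>a\<close> and \<open>t\<close>
  acts on the monoid and permutes the factors \<open>(t, z)\<close>, hence fixes the product.\<close>

lemma symmetric_norm:
  assumes a: "a \<in> carrier R" and t: "t \<in> carrier R"
    and Z: "finite Z" "Z \<subseteq> carrier R" and r: "r \<in> Z"
  obtains s y where "s \<in> carrier R" "y \<in> carrier R"
    "t [^] card Z \<oplus> a \<otimes> s = (t \<oplus> a \<otimes> r) \<otimes> y"
    "\<And>\<sigma>. \<sigma> \<in> ring_hom R R \<Longrightarrow> \<sigma> ` Z = Z \<Longrightarrow> \<sigma> a = a \<Longrightarrow> \<sigma> t = t \<Longrightarrow> \<sigma> s = s"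
proof -
  interpret M: comm_monoid "norm_monoid a" by (rule comm_monoid_norm_monoid[OF a])
  have M_carr: "carrier (norm_monoid a) = carrier R \<times> carrier R"
    by (simp add: norm_monoid_def)
  define N where "N Y = finprod (norm_monoid a) (Pair t) Y" for Y
  have N_carr: "N Y \<in> carrier R \<times> carrier R" if "Y \<subseteq> carrier R" for Y
    unfolding N_def M_carr[symmetric] using that t
    by (intro M.finprod_closed) (auto simp: M_carr)
  have N_empty: "N {} = (\<one>, \<zero>)"
    unfolding N_def M.finprod_empty by (simp add: norm_monoid_def)
  have N_insert: "N (insert y Y) = (t, y) \<otimes>\<^bsub>norm_monoid a\<^esub> N Y"
    if "finite Y" "y \<notin> Y" "insert y Y \<subseteq> carrier R" for y Y
    unfolding N_def using that t by (intro M.finprod_insert) (auto simp: M_carr)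
  have fst_N: "fst (N Y) = t [^] card Y" if "finite Y" "Y \<subseteq> carrier R" for Y
    using that
  proof (induction Y)
    case empty
    show ?case by (simp add: N_empty)
  next
    case (insert y Y)
    then show ?case using t
      by (simp add: N_insert) (simp add: norm_monoid_def split_def m_comm)
  qed
  have N_map: "map_prod \<sigma> \<sigma> (N Y) = N (\<sigma> ` Y)"
    if \<sigma>: "\<sigma> \<in> ring_hom R R" "\<sigma> a = a" "\<sigma> t = t"
      and Y: "finite Y" "Y \<subseteq> carrier R" "inj_on \<sigma> Y" for \<sigma> Y
  proof -
    interpret \<sigma>: ring_hom_cring R R \<sigma>
      using \<sigma> is_cring by (intro ring_hom_cring.intro ring_hom_cring_axioms.intro)
    show ?thesis using Y
    proof (induction Y)
      case empty
      show ?case by (simp add: N_empty)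
    next
      case (insert y Y)
      have "\<sigma> ` Y \<subseteq> carrier R" "\<sigma> y \<in> carrier R" "\<sigma> y \<notin> \<sigma> ` Y" using insert by auto
      then have "N (\<sigma> ` insert y Y) = (t, \<sigma> y) \<otimes>\<^bsub>norm_monoid a\<^esub> N (\<sigma> ` Y)"
        using N_insert[of "\<sigma> ` Y" "\<sigma> y"] insert by simp
      also have "\<dots> = (t, \<sigma> y) \<otimes>\<^bsub>norm_monoid a\<^esub> map_prod \<sigma> \<sigma> (N Y)"
        using insert by simp
      also have "\<dots> = map_prod \<sigma> \<sigma> ((t, y) \<otimes>\<^bsub>norm_monoid a\<^esub> N Y)"
      proof -
        obtain c d where "N Y = (c, d)" "c \<in> carrier R" "d \<in> carrier R"
          using N_carr[of Y] insert.prems(1) by auto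
        then show ?thesis using insert.prems(1) t a \<sigma>(2,3) by (simp add: norm_monoid_def)
      qed
      finally show ?case using insert by (simp add: N_insert)
    qed
  qed
  \<comment> \<open>Splitting off the factor \<open>(t, r)\<close> shows that the expanded product is a multiple of \<open>t + a r\<close>;
    the cofactor is the expression denoted by the product of the remaining pairs.\<close>
  let ?Y = "Z - {r}"
  have Y: "?Y \<subseteq> carrier R" "finite ?Y" "insert r ?Y = Z" "r \<in> carrier R" using Z r by auto
  obtain c d where N_Y: "N ?Y = (c, d)" and cd: "c \<in> carrier R" "d \<in> carrier R"
    using N_carr[OF Y(1)] by (auto elim!: SigmaE)
  have "N (insert r ?Y) = (t, r) \<otimes>\<^bsub>norm_monoid a\<^esub> N ?Y"
    by (rule N_insert) (use Y in auto)
  then have N_Z: "N Z = (t \<otimes> c, t \<otimes> d \<oplus> c \<otimes> r \<oplus> a \<otimes> (r \<otimes> d))"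
    unfolding Y(3) N_Y by (simp add: norm_monoid_def)
  have "t [^] card Z \<oplus> a \<otimes> snd (N Z) = (t \<oplus> a \<otimes> r) \<otimes> (c \<oplus> a \<otimes> d)"
    unfolding fst_N[OF Z, symmetric] N_Z using a t Y(4) cd
    by (simp add: l_distr r_distr m_ac a_ac)
  moreover have "\<sigma> (snd (N Z)) = snd (N Z)"
    if "\<sigma> \<in> ring_hom R R" "\<sigma> ` Z = Z" "\<sigma> a = a" "\<sigma> t = t" for \<sigma>
  proof -
    have "inj_on \<sigma> Z" using that Z by (simp add: eq_card_imp_inj_on)
    then have "map_prod \<sigma> \<sigma> (N Z) = N Z" using N_map[of \<sigma> Z] that Z by simp
    then show ?thesis by (metis snd_map_prod)
  qed
  moreover have "snd (N Z) \<in> carrier R" using N_carr[OF Z(2)] by auto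
  moreover have "c \<oplus> a \<otimes> d \<in> carrier R" using a cd by simp
  ultimately show ?thesis by (intro that[of "snd (N Z)" "c \<oplus> a \<otimes> d"]) assumption+
qed

end

section \<open>Fixed rings\<close>

lemma ring_aut_subgroupD:
  fixes R (structure)
  assumes "ring R" and G: "subgroup G (RingAutGroup R)"
  shows "\<And>\<sigma>. \<sigma> \<in> G \<Longrightarrow> \<sigma> \<in> ring_hom R R"
    and "\<And>\<sigma>. \<sigma> \<in> G \<Longrightarrow> inj_on \<sigma> (carrier R)"
    and "\<exists>\<sigma>\<in>G. \<forall>x\<in>carrier R. \<sigma> x = x"
    and "\<And>\<sigma> \<tau>. \<sigma> \<in> G \<Longrightarrow> \<tau> \<in> G \<Longrightarrow> \<exists>\<rho>\<in>G. \<forall>x\<in>carrier R. \<rho> x = \<sigma> (\<tau> x)"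
proof -
  interpret ring R by fact
  interpret subgroup G "RingAutGroup R" by fact
  have aut: "\<sigma> \<in> ring_hom R R" "\<sigma> \<in> Bij (carrier R)" if "\<sigma> \<in> G" for \<sigma>
    using that subset by (auto simp: RingAutGroup_def ring_auto_alt)
  show "\<And>\<sigma>. \<sigma> \<in> G \<Longrightarrow> \<sigma> \<in> ring_hom R R" by (rule aut)
  show "\<And>\<sigma>. \<sigma> \<in> G \<Longrightarrow> inj_on \<sigma> (carrier R)"
    using aut(2) by (auto simp: Bij_def bij_betw_def)
  show "\<exists>\<sigma>\<in>G. \<forall>x\<in>carrier R. \<sigma> x = x"
    using one_closed by (intro bexI[of _ "\<one>\<^bsub>RingAutGroup R\<^esub>"])
      (auto simp: RingAutGroup_def BijGroup_def)
  show "\<exists>\<rho>\<in>G. \<forall>x\<in>carrier R. \<rho> x = \<sigma> (\<tau> x)" if "\<sigma> \<in> G" "\<tau> \<in> G" for \<sigma> \<tau>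
    using m_closed[OF that] aut(2)[OF that(1)] aut(2)[OF that(2)]
    by (intro bexI[of _ "\<sigma> \<otimes>\<^bsub>RingAutGroup R\<^esub> \<tau>"])
      (auto simp: RingAutGroup_def BijGroup_def compose_def)
qed

text \<open>Finiteness of the orbit turns the inclusion of its image, together with injectivity, into
  equality.\<close>

lemma orbit_stable:
  fixes R (structure)
  assumes "ring R" "subgroup G (RingAutGroup R)" "locally_finite_action R G"
    and r: "r \<in> carrier R" and \<sigma>: "\<sigma> \<in> G"
  shows "\<sigma> ` {\<tau> r |\<tau>. \<tau> \<in> G} = {\<tau> r |\<tau>. \<tau> \<in> G}"
proof (rule endo_inj_surj)
  note G = ring_aut_subgroupD[OF assms(1,2)]
  show "finite {\<tau> r |\<tau>. \<tau> \<in> G}"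
    using assms(3) r by (simp add: locally_finite_action_def)
  show "\<sigma> ` {\<tau> r |\<tau>. \<tau> \<in> G} \<subseteq> {\<tau> r |\<tau>. \<tau> \<in> G}"
  proof clarify
    fix \<tau> assume "\<tau> \<in> G"
    with G(4)[OF \<sigma> this] r show "\<exists>\<rho>. \<sigma> (\<tau> r) = \<rho> r \<and> \<rho> \<in> G" by metis
  qed
  have "{\<tau> r |\<tau>. \<tau> \<in> G} \<subseteq> carrier R" using G(1) r by (auto intro: ring_hom_closed)
  then show "inj_on \<sigma> {\<tau> r |\<tau>. \<tau> \<in> G}" using inj_on_subset[OF G(2)[OF \<sigma>]] by blast
qed

text \<open>The symmetric norm over the orbit of \<open>r\<close>. It serves as the substitute for integrality of the
  ring over its fixed ring: factors with coefficient \<open>r\<close> in the big ring are cleared at the cost of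
  raising \<open>t\<close> to a power.\<close>

lemma fixed_ring_norm:
  fixes R (structure)
  assumes "cring R" "subgroup G (RingAutGroup R)" "locally_finite_action R G"
    and a: "a \<in> carrier (fixed_ring R G)" and t: "t \<in> carrier (fixed_ring R G)"
    and r: "r \<in> carrier R"
  obtains n :: nat and s y where "s \<in> carrier (fixed_ring R G)" "y \<in> carrier R"
    "t [^] n \<oplus> a \<otimes> s = (t \<oplus> a \<otimes> r) \<otimes> y"
proof -
  interpret cring R by fact
  note G = ring_aut_subgroupD[OF ring_axioms assms(2)]
  let ?X = "{\<tau> r |\<tau>. \<tau> \<in> G}"
  have fin: "finite ?X" using assms(3) r by (simp add: locally_finite_action_def)
  have sub: "?X \<subseteq> carrier R" using G(1) r by (auto intro: ring_hom_closed)
  have "r \<in> ?X" using G(3) r by (metis (mono_tags, lifting) mem_Collect_eq)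
  have at: "a \<in> carrier R" "t \<in> carrier R" using a t by (auto simp: fixed_ring_def)
  obtain s y where s: "s \<in> carrier R" "y \<in> carrier R"
      "t [^] card ?X \<oplus> a \<otimes> s = (t \<oplus> a \<otimes> r) \<otimes> y"
    and sym: "\<And>\<sigma>. \<sigma> \<in> ring_hom R R \<Longrightarrow> \<sigma> ` ?X = ?X \<Longrightarrow> \<sigma> a = a \<Longrightarrow> \<sigma> t = t \<Longrightarrow> \<sigma> s = s"
    using symmetric_norm[OF at fin sub \<open>r \<in> ?X\<close>] by blast
  have "\<sigma> s = s" if "\<sigma> \<in> G" for \<sigma>
    using sym[OF G(1)[OF that] orbit_stable[OF ring_axioms assms(2,3) r that]] a t that
    by (auto simp: fixed_ring_def)
  then have "s \<in> carrier (fixed_ring R G)" using s by (simp add: fixed_ring_def)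
  then show ?thesis using that s by blast
qed

lemma subcring_fixed_ring:
  fixes R (structure)
  assumes "cring R" "\<And>\<sigma>. \<sigma> \<in> G \<Longrightarrow> \<sigma> \<in> ring_hom R R"
  shows "subcring (carrier (fixed_ring R G)) R"
proof -
  interpret cring R by fact
  have fixes_ops: "\<sigma> \<one> = \<one>" "\<sigma> (\<ominus> x) = \<ominus> x"
    "\<sigma> (x \<otimes> y) = x \<otimes> y" "\<sigma> (x \<oplus> y) = x \<oplus> y"
    if \<sigma>: "\<sigma> \<in> G" and x: "x \<in> carrier R" "\<sigma> x = x" and y: "y \<in> carrier R" "\<sigma> y = y" for \<sigma> x y
  proof -
    interpret \<sigma>: ring_hom_cring R R \<sigma>
      using assms(2)[OF \<sigma>] is_cring by (intro ring_hom_cring.intro ring_hom_cring_axioms.intro)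
    show "\<sigma> \<one> = \<one>" "\<sigma> (\<ominus> x) = \<ominus> x" "\<sigma> (x \<otimes> y) = x \<otimes> y" "\<sigma> (x \<oplus> y) = x \<oplus> y"
      using x y by simp_all
  qed
  have "\<one> \<in> carrier (fixed_ring R G)"
    using ring_hom_one[OF assms(2)] by (auto simp: fixed_ring_def)
  then show ?thesis
    by (intro subcringI' subringI) (auto simp: fixed_ring_def intro: fixes_ops)
qed

theorem theorem2p8:
  fixes R :: "('a, 'b) ring_scheme" and G :: "('a \<Rightarrow> 'a) set"
  assumes "cring R"
    and "subgroup G (RingAutGroup R)"
    and "locally_finite_action R G"
    and "Hilbert_ring R"
  shows "Hilbert_ring (fixed_ring R G)"
proof -
  interpret cring R by fact
  let ?A = "fixed_ring R G"
  note norm = fixed_ring_norm[OF assms(1-3)]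
  have sub: "subcring (carrier ?A) R"
    using ring_aut_subgroupD(1)[OF ring_axioms assms(2)] by (rule subcring_fixed_ring[OF is_cring])
  have A_sub: "carrier ?A \<subseteq> carrier R" by (auto simp: fixed_ring_def)
  have A_eq: "R\<lparr>carrier := carrier ?A\<rparr> = ?A" by (simp add: fixed_ring_def)
  interpret A: cring ?A using subcring_iff[OF A_sub] sub A_eq by simp
  have ops: "x \<otimes>\<^bsub>?A\<^esub> y = x \<otimes>\<^bsub>R\<^esub> y" "x \<oplus>\<^bsub>?A\<^esub> y = x \<oplus>\<^bsub>R\<^esub> y" "\<one>\<^bsub>?A\<^esub> = \<one>\<^bsub>R\<^esub>" "\<zero>\<^bsub>?A\<^esub> = \<zero>\<^bsub>R\<^esub>"
    "x [^]\<^bsub>?A\<^esub> n = x [^]\<^bsub>R\<^esub> n" for x y and n :: nat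
    by (simp_all add: fixed_ring_def nat_pow_def)
  have "maximalideal P ?A" if "G_ideal P ?A" for P
  proof -
    from that obtain u where "primeideal P ?A" and u: "u \<in> carrier ?A - P"
      and div: "\<And>b. b \<in> carrier ?A - P \<Longrightarrow>
        \<exists>n::nat. \<exists>c\<in>carrier ?A. \<exists>q\<in>P. u [^]\<^bsub>R\<^esub> n = b \<otimes>\<^bsub>R\<^esub> c \<oplus>\<^bsub>R\<^esub> q"
      unfolding G_ideal_iff_divides_power ops by blast
    interpret P: primeideal P ?A by fact
    have P_one: "\<one>\<^bsub>R\<^esub> \<notin> P" using P.one_imp_carrier P.I_notcarr by (auto simp: ops)
    have P_pow: "t \<in> P" if "t \<in> carrier ?A" "t [^]\<^bsub>R\<^esub> n \<in> P" for t and n :: nat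
      using that(2)
    proof (induction n)
      case 0
      then show ?case using P_one by simp
    next
      case (Suc n)
      then have "t [^]\<^bsub>?A\<^esub> n \<otimes>\<^bsub>?A\<^esub> t \<in> P" by (simp add: ops)
      then have "t [^]\<^bsub>?A\<^esub> n \<in> P \<or> t \<in> P" using that(1) by (intro P.I_prime) auto
      then show ?case using Suc.IH by (auto simp: ops)
    qed
    let ?S = "carrier ?A - P"
    have S: "?S \<subseteq> carrier R" "\<one>\<^bsub>R\<^esub> \<in> ?S" "\<zero>\<^bsub>R\<^esub> \<notin> ?S"
      using A_sub A.one_closed P_one P.zero_closed by (auto simp: ops)
    have S_mult: "s \<otimes>\<^bsub>R\<^esub> t \<in> ?S" if "s \<in> ?S" "t \<in> ?S" for s t
      using that P.I_prime[of s t] A.m_closed[of s t] by (auto simp: ops)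
    obtain Q where "primeideal Q R" and Q_S: "Q \<inter> ?S = {}"
      and Q_max: "\<forall>b \<in> carrier R - Q. \<exists>s\<in>?S. \<exists>c\<in>carrier R. \<exists>q\<in>Q. s = b \<otimes>\<^bsub>R\<^esub> c \<oplus>\<^bsub>R\<^esub> q"
      by (rule prime_ideal_avoiding_submonoid[OF S(1,2) S_mult S(3)])
    interpret Q: primeideal Q R by fact
    \<comment> \<open>A relation modulo \<open>Q\<close> with a coefficient \<open>c\<close> in \<open>R\<close> is pushed down to one modulo \<open>P\<close>:
      the norm is a multiple of \<open>t - a c = q\<close>, and it is fixed, so it lies in \<open>Q \<inter> A \<subseteq> P\<close>.\<close>
    have norm_in_P: "\<exists>n::nat. \<exists>s\<in>carrier ?A. t [^]\<^bsub>R\<^esub> n \<oplus>\<^bsub>R\<^esub> a \<otimes>\<^bsub>R\<^esub> s \<in> P"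
      if a: "a \<in> carrier ?A" and t: "t \<in> carrier ?A" and c: "c \<in> carrier R" and q: "q \<in> Q"
        and eq: "t = a \<otimes>\<^bsub>R\<^esub> c \<oplus>\<^bsub>R\<^esub> q" for a t c q
    proof -
      obtain n :: nat and s y where s: "s \<in> carrier ?A" "y \<in> carrier R"
        "t [^]\<^bsub>R\<^esub> n \<oplus>\<^bsub>R\<^esub> a \<otimes>\<^bsub>R\<^esub> s = (t \<oplus>\<^bsub>R\<^esub> a \<otimes>\<^bsub>R\<^esub> (\<ominus>\<^bsub>R\<^esub> c)) \<otimes>\<^bsub>R\<^esub> y"
        by (rule norm[OF a t a_inv_closed[OF c]])
      have aR: "a \<in> carrier R" and qR: "q \<in> carrier R" using a A_sub q by (auto dest: Q.Icarr)
      have "t \<oplus>\<^bsub>R\<^esub> a \<otimes>\<^bsub>R\<^esub> (\<ominus>\<^bsub>R\<^esub> c) = (q \<oplus>\<^bsub>R\<^esub> a \<otimes>\<^bsub>R\<^esub> c) \<oplus>\<^bsub>R\<^esub> \<ominus>\<^bsub>R\<^esub> (a \<otimes>\<^bsub>R\<^esub> c)"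
        using aR c qR unfolding eq by (simp add: r_minus a_comm)
      also have "\<dots> = q" using aR c qR by (simp add: a_assoc r_neg)
      finally have "t \<oplus>\<^bsub>R\<^esub> a \<otimes>\<^bsub>R\<^esub> (\<ominus>\<^bsub>R\<^esub> c) = q" .
      then have "t [^]\<^bsub>R\<^esub> n \<oplus>\<^bsub>R\<^esub> a \<otimes>\<^bsub>R\<^esub> s \<in> Q" using s q by (simp add: Q.I_r_closed)
      moreover have "t [^]\<^bsub>?A\<^esub> n \<oplus>\<^bsub>?A\<^esub> a \<otimes>\<^bsub>?A\<^esub> s \<in> carrier ?A" using a t s by simp
      ultimately have "t [^]\<^bsub>R\<^esub> n \<oplus>\<^bsub>R\<^esub> a \<otimes>\<^bsub>R\<^esub> s \<in> P" using Q_S unfolding ops by blast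
      then show ?thesis using s(1) by blast
    qed
    have P_Q: "a \<in> Q" if "a \<in> P" for a
    proof (rule ccontr)
      assume "a \<notin> Q"
      have a: "a \<in> carrier ?A" using that by (rule P.Icarr)
      then obtain t c q where t: "t \<in> ?S" "c \<in> carrier R" "q \<in> Q" "t = a \<otimes>\<^bsub>R\<^esub> c \<oplus>\<^bsub>R\<^esub> q"
        using Q_max[rule_format, of a] A_sub \<open>a \<notin> Q\<close> by blast
      then obtain n :: nat and s where s: "s \<in> carrier ?A" "t [^]\<^bsub>R\<^esub> n \<oplus>\<^bsub>R\<^esub> a \<otimes>\<^bsub>R\<^esub> s \<in> P"
        using norm_in_P[OF a, of t c q] by blast
      \<comment> \<open>As \<open>a\<close> is in \<open>P\<close>, so is the power of \<open>t\<close>, although \<open>t\<close> was taken outside \<open>P\<close>.\<close>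
      have "t [^]\<^bsub>?A\<^esub> n \<in> carrier ?A" using t by simp
      moreover have "a \<otimes>\<^bsub>?A\<^esub> s \<in> P" using that s by (simp add: P.I_r_closed)
      moreover have "t [^]\<^bsub>?A\<^esub> n \<oplus>\<^bsub>?A\<^esub> a \<otimes>\<^bsub>?A\<^esub> s \<in> P" unfolding ops by (rule s(2))
      ultimately have "t [^]\<^bsub>?A\<^esub> n \<in> P" by (rule P.mem_of_add_mem)
      then have "t [^]\<^bsub>R\<^esub> n \<in> P" unfolding ops .
      then have "t \<in> P" using P_pow[of t n] t(1) by blast
      then show False using t(1) by blast
    qed
    \<comment> \<open>The witness \<open>u\<close> for \<open>P\<close> also works for \<open>Q\<close>: a power of it is divisible modulo \<open>P\<close>, hence
      modulo \<open>Q\<close>, by some \<open>t\<close> in \<open>A - P\<close> that is itself a multiple of \<open>b\<close> modulo \<open>Q\<close>.\<close>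
    have "G_ideal Q R"
      unfolding G_ideal_iff_divides_power
    proof (intro conjI bexI ballI)
      show "primeideal Q R" by fact
      show "u \<in> carrier R - Q" using u Q_S A_sub by blast
      fix b assume b: "b \<in> carrier R - Q"
      then obtain t c q where t: "t \<in> ?S" "c \<in> carrier R" "q \<in> Q" "t = b \<otimes>\<^bsub>R\<^esub> c \<oplus>\<^bsub>R\<^esub> q"
        using Q_max[rule_format, OF b] by blast
      then obtain n :: nat and d q' where d: "d \<in> carrier ?A" "q' \<in> P"
        "u [^]\<^bsub>R\<^esub> n = t \<otimes>\<^bsub>R\<^esub> d \<oplus>\<^bsub>R\<^esub> q'" using div by blast
      have carr: "d \<in> carrier R" "q' \<in> Q" "q' \<in> carrier R" "q \<in> carrier R"
        using d t A_sub P_Q Q.Icarr by auto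
      have "u [^]\<^bsub>R\<^esub> n = b \<otimes>\<^bsub>R\<^esub> (c \<otimes>\<^bsub>R\<^esub> d) \<oplus>\<^bsub>R\<^esub> (q \<otimes>\<^bsub>R\<^esub> d \<oplus>\<^bsub>R\<^esub> q')"
        unfolding d(3) t(4) using b t(2) carr by (simp add: l_distr m_assoc a_assoc)
      moreover have "q \<otimes>\<^bsub>R\<^esub> d \<oplus>\<^bsub>R\<^esub> q' \<in> Q" using t carr by (simp add: Q.I_r_closed)
      ultimately show "\<exists>n::nat. \<exists>c\<in>carrier R. \<exists>q\<in>Q. u [^]\<^bsub>R\<^esub> n = b \<otimes>\<^bsub>R\<^esub> c \<oplus>\<^bsub>R\<^esub> q"
        using t carr by blast
    qed
    then have "maximalideal Q R" using assms(4) by (simp add: Hilbert_ring_def)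
    then have Q_unit: "\<exists>c\<in>carrier R. \<exists>q\<in>Q. \<one>\<^bsub>R\<^esub> = b \<otimes>\<^bsub>R\<^esub> c \<oplus>\<^bsub>R\<^esub> q" if "b \<in> carrier R - Q" for b
      using maximalideal_iff_unit_mod[OF Q.is_ideal] that by blast
    show ?thesis
      unfolding A.maximalideal_iff_unit_mod[OF P.is_ideal] ops
    proof (intro conjI ballI)
      show "\<one>\<^bsub>R\<^esub> \<notin> P" by fact
      fix b assume b: "b \<in> ?S"
      then obtain c q where c: "c \<in> carrier R" "q \<in> Q" "\<one>\<^bsub>R\<^esub> = b \<otimes>\<^bsub>R\<^esub> c \<oplus>\<^bsub>R\<^esub> q"
        using Q_unit[of b] A_sub Q_S by blast
      have "\<exists>s\<in>carrier ?A. \<one>\<^bsub>R\<^esub> \<oplus>\<^bsub>R\<^esub> b \<otimes>\<^bsub>R\<^esub> s \<in> P"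
        using norm_in_P[OF _ _ c] b S(2) by simp
      then obtain s where s: "s \<in> carrier ?A" "\<one>\<^bsub>R\<^esub> \<oplus>\<^bsub>R\<^esub> b \<otimes>\<^bsub>R\<^esub> s \<in> P"
        by blast
      \<comment> \<open>So \<open>- s\<close> inverts \<open>b\<close> modulo \<open>P\<close>.\<close>
      have "\<ominus>\<^bsub>?A\<^esub> s \<in> carrier ?A" using s by simp
      moreover have "\<one>\<^bsub>?A\<^esub> = b \<otimes>\<^bsub>?A\<^esub> (\<ominus>\<^bsub>?A\<^esub> s) \<oplus>\<^bsub>?A\<^esub> (\<one>\<^bsub>?A\<^esub> \<oplus>\<^bsub>?A\<^esub> b \<otimes>\<^bsub>?A\<^esub> s)"
        using b s by (simp add: A.r_minus A.a_lcomm[of "\<ominus>\<^bsub>?A\<^esub> (b \<otimes>\<^bsub>?A\<^esub> s)"] A.l_neg)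
      ultimately show "\<exists>c\<in>carrier ?A. \<exists>q\<in>P. \<one>\<^bsub>R\<^esub> = b \<otimes>\<^bsub>R\<^esub> c \<oplus>\<^bsub>R\<^esub> q"
        using s by (auto simp: ops)
    qed
  qed
  then show ?thesis by (simp add: Hilbert_ring_def A.is_cring)
qed

end
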